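(* Let $M$ be a non-orientable Riemannian surface with orientation double cover $\pi:\widetilde M\to M$ and deck involution $\tau$. Let $\widetilde G$ be the Green's function of the Laplacian on $\widetilde M$ and $\widetilde R$ its Robin function. For $x,y\in M$ with chosen lifts $\tilde x,\tilde y\in\widetilde M$ put $$G_M(x,y)=\widetilde G(\tilde x,\tilde y)-\widetilde G(\tilde x,\tau(\tilde y)),\qquad R_M(x)=\widetilde R(\tilde x)-\widetilde G(\tilde x,\tau(\tilde x)).$$ Then: (i) $G_M$ is a twisted Green's function of the Laplacian on $M$: it is twisted in each of its arguments (replacing $\tilde x$ by $\tau(\tilde x)$, or $\tilde y$ by $\tau(\tilde y)$, changes its sign) and, as a function of $\tilde x\in\widetilde M$ for fixed $\tilde y$, it satisfies $$\Delta_{\tilde x}\big(\widetilde G(\tilde x,\tilde y)-\widetilde G(\tilde x,\tau(\tilde y))\big)=\delta_{\tilde y}(\tilde x)-\delta_{\tau(\tilde y)}(\tilde x).$$ (ii) $R_M$ is the Robin function of $G_M$: it is a regular function on $M$ (independent of the choice of lift) and $$R_M(y)=\lim_{\tilde x\to\tilde y}\Big(\widetilde G(\tilde x,\tilde y)-\widetilde G(\tilde x,\tau(\tilde y))-\tfrac1{2\pi}\log d(\tilde x,\tilde y)\Big)$$ for either lift $\tilde y$ of $y$.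
   Context: $\widetilde M$ consists of pairs (point of $M$, orientation at that point), with the Riemannian metric lifted from $M$. The involution $\tau$ swaps the two points in each fibre and is an isometry of $\widetilde M$. $\Delta$ is the Laplace–Beltrami operator and $d$ the geodesic distance on $\widetilde M$. The (hydrodynamic) Green's function $\widetilde G(\tilde x,\tilde y)$ is symmetric, smooth off the diagonal, invariant under isometries (in particular $\widetilde G(\tau \tilde x,\tau \tilde y)=\widetilde G(\tilde x,\tilde y)$), and satisfies $\Delta_{\tilde x}\widetilde G(\tilde x,\tilde y)=\delta_{\tilde y}(\tilde x)$. When $\widetilde M$ is compact, the right-hand side is instead $\delta_{\tilde y}(\tilde x)-1/\mathrm{Area}(\widetilde M)$. Its Robin function is $\widetilde R(\tilde x)=\lim_{\tilde y\to \tilde x}\big(\widetilde G(\tilde x,\tilde y)-\frac1{2\pi}\log d(\tilde x,\tilde y)\big)$, which is assumed to exist. A function $f$ on $\widetilde M$ is a regular function on $M$ if $f\circ\tau=f$ and a twisted function on $M$ if $f\circ\tau=-f$. *)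

theory Defs
  imports "HOL-Analysis.Analysis"
begin

section \<open>Smooth maps between Euclidean spaces\<close>

text \<open>Only used on open sets \<open>S\<close>, where the values of \<open>f\<close> outside \<open>S\<close> are irrelevant.\<close>

primrec Ck_on :: "nat \<Rightarrow> 'a set \<Rightarrow> ('a::euclidean_space \<Rightarrow> 'b::real_normed_vector) \<Rightarrow> bool" where
  "Ck_on 0 S f \<longleftrightarrow> continuous_on S f"
| "Ck_on (Suc k) S f \<longleftrightarrow>
     (\<forall>x\<in>S. f differentiable (at x)) \<and>
     (\<forall>v. Ck_on k S (\<lambda>x. frechet_derivative f (at x) v))"

definition smooth_on :: "'a set \<Rightarrow> ('a::euclidean_space \<Rightarrow> 'b::real_normed_vector) \<Rightarrow> bool" where
  "smooth_on S f \<longleftrightarrow> (\<forall>k. Ck_on k S f)"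

definition jacobian :: "(real^2 \<Rightarrow> real^2) \<Rightarrow> real^2 \<Rightarrow> real^2^2" where
  "jacobian F x = matrix (frechet_derivative F (at x))"

definition partial :: "2 \<Rightarrow> (real^2 \<Rightarrow> real) \<Rightarrow> real^2 \<Rightarrow> real" where
  "partial a f x = frechet_derivative f (at x) (axis a 1)"


section \<open>Riemannian surfaces\<close>

text \<open>
  A surface is given by a topology, an indexed atlas (the chart with index \<open>i\<close> has domain
  \<open>cdom i\<close> and coordinate map \<open>coord i\<close>), and the Gram matrices \<open>gram i x\<close> of the metric
  in the coordinates of chart \<open>i\<close> at the coordinate point \<open>x\<close>.  The atlas need not be maximal.
\<close>

record ('p, 'i) surface =
  topo :: "'p topology"
  charts :: "'i set"
  cdom :: "'i \<Rightarrow> 'p set"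
  coord :: "'i \<Rightarrow> 'p \<Rightarrow> real^2"
  gram :: "'i \<Rightarrow> real^2 \<Rightarrow> real^2^2"

abbreviation pts :: "('p, 'i) surface \<Rightarrow> 'p set" where
  "pts S \<equiv> topspace (topo S)"

definition cinv :: "('p, 'i) surface \<Rightarrow> 'i \<Rightarrow> real^2 \<Rightarrow> 'p" where
  "cinv S i = inv_into (cdom S i) (coord S i)"

definition transition :: "('p, 'i) surface \<Rightarrow> 'i \<Rightarrow> 'i \<Rightarrow> real^2 \<Rightarrow> real^2" where
  "transition S i j = coord S j \<circ> cinv S i"

definition riemannian_surface :: "('p, 'i) surface \<Rightarrow> bool" where
  "riemannian_surface S \<longleftrightarrow>
     Hausdorff_space (topo S) \<and> second_countable (topo S) \<and>
     (\<Union>i\<in>charts S. cdom S i) = pts S \<and>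
     (\<forall>i\<in>charts S.
        openin (topo S) (cdom S i) \<and>
        open (coord S i ` cdom S i) \<and>
        homeomorphic_map (subtopology (topo S) (cdom S i))
          (top_of_set (coord S i ` cdom S i)) (coord S i)) \<and>
     (\<forall>i\<in>charts S. \<forall>j\<in>charts S.
        smooth_on (coord S i ` (cdom S i \<inter> cdom S j)) (transition S i j)) \<and>
     (\<forall>i\<in>charts S.
        smooth_on (coord S i ` cdom S i) (gram S i) \<and>
        (\<forall>x\<in>coord S i ` cdom S i.
           transpose (gram S i x) = gram S i x \<and>
           (\<forall>v. v \<noteq> 0 \<longrightarrow> v \<bullet> (gram S i x *v v) > 0))) \<and>
     (\<forall>i\<in>charts S. \<forall>j\<in>charts S. \<forall>x\<in>coord S i ` (cdom S i \<inter> cdom S j).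
        gram S i x =
          transpose (jacobian (transition S i j) x) ** gram S j (transition S i j x)
            ** jacobian (transition S i j) x)"

definition smooth_fun :: "('p, 'i) surface \<Rightarrow> ('p \<Rightarrow> real) \<Rightarrow> bool" where
  "smooth_fun S u \<longleftrightarrow> (\<forall>i\<in>charts S. smooth_on (coord S i ` cdom S i) (u \<circ> cinv S i))"

definition test_fun :: "('p, 'i) surface \<Rightarrow> ('p \<Rightarrow> real) \<Rightarrow> bool" where
  "test_fun S u \<longleftrightarrow> smooth_fun S u \<and> (\<exists>K. compactin (topo S) K \<and> (\<forall>p\<in>pts S - K. u p = 0))"

text \<open>
  The inverse of a bijective isometry is smooth by the inverse function theorem, because its
  Jacobians are invertible; so smoothness of \<open>F\<close> alone is demanded.
\<close>

definition isometry :: "('p, 'i) surface \<Rightarrow> ('p \<Rightarrow> 'p) \<Rightarrow> bool" where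
  "isometry S F \<longleftrightarrow>
     homeomorphic_map (topo S) (topo S) F \<and>
     (\<forall>i\<in>charts S. \<forall>j\<in>charts S.
        (let W = coord S i ` {p \<in> cdom S i. F p \<in> cdom S j};
             F' = coord S j \<circ> F \<circ> cinv S i
         in smooth_on W F' \<and>
            (\<forall>x\<in>W. gram S i x =
               transpose (jacobian F' x) ** gram S j (F' x) ** jacobian F' x)))"

text \<open>
  The Laplace--Beltrami operator in a chart:
  \<open>\<Delta>u = (1/\<surd>g) \<Sum>\<^sub>a \<partial>\<^sub>a (\<surd>g \<Sum>\<^sub>b g\<^sup>a\<^sup>b \<partial>\<^sub>b u)\<close>.
  For smooth \<open>u\<close> its value at a point does not depend on the chart chosen there.
\<close>

definition chart_laplacian ::
    "('p, 'i) surface \<Rightarrow> 'i \<Rightarrow> ('p \<Rightarrow> real) \<Rightarrow> real^2 \<Rightarrow> real" where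
  "chart_laplacian S i u x =
     (\<Sum>a\<in>UNIV. partial a
        (\<lambda>y. sqrt (det (gram S i y)) *
             (\<Sum>b\<in>UNIV. matrix_inv (gram S i y) $ a $ b * partial b (u \<circ> cinv S i) y)) x)
     / sqrt (det (gram S i x))"

definition laplacian :: "('p, 'i) surface \<Rightarrow> ('p \<Rightarrow> real) \<Rightarrow> 'p \<Rightarrow> real" where
  "laplacian S u p =
     (let i = (SOME i. i \<in> charts S \<and> p \<in> cdom S i) in chart_laplacian S i u (coord S i p))"

text \<open>
  The Riemannian area: the Borel measure with density \<open>\<surd>g\<close> in every chart. It exists and is
  unique on a Riemannian surface by second countability.
\<close>

definition area :: "('p, 'i) surface \<Rightarrow> 'p measure" where
  "area S = (THE \<mu>.
     space \<mu> = pts S \<and> sets \<mu> = sigma_sets (pts S) {U. openin (topo S) U} \<and>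
     (\<forall>i\<in>charts S. \<forall>A\<in>sets \<mu>. A \<subseteq> cdom S i \<longrightarrow>
        emeasure \<mu> A =
          (\<integral>\<^sup>+x. ennreal (sqrt (det (gram S i x))) * indicator (coord S i ` A) x \<partial>lborel)))"

text \<open>
  \<open>curve_length S p q l\<close>: there is a piecewise \<open>C\<^sup>1\<close> curve of length \<open>l\<close> from \<open>p\<close> to \<open>q\<close>.  By
  compactness, such a curve is a finite concatenation of \<open>C\<^sup>1\<close> arcs \<open>c : [0,1] \<rightarrow> \<real>\<^sup>2\<close> each
  lying in a single chart. (Values of \<open>c\<close> outside \<open>[0,1]\<close> only serve the two-sided derivatives
  at the end points; any arc that is \<open>C\<^sup>1\<close> on the closed interval has such an extension.)
\<close>

inductive curve_length :: "('p, 'i) surface \<Rightarrow> 'p \<Rightarrow> 'p \<Rightarrow> real \<Rightarrow> bool"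
  for S :: "('p, 'i) surface" where
  const: "p \<in> pts S \<Longrightarrow> curve_length S p p 0"
| append_arc: "curve_length S p q l \<Longrightarrow> i \<in> charts S \<Longrightarrow> q \<in> cdom S i \<Longrightarrow>
     c C1_differentiable_on {0..1} \<Longrightarrow> c ` {0..1} \<subseteq> coord S i ` cdom S i \<Longrightarrow>
     c 0 = coord S i q \<Longrightarrow>
     curve_length S p (cinv S i (c 1))
       (l + integral {0..1} (\<lambda>t. sqrt (vector_derivative c (at t) \<bullet>
                                      (gram S i (c t) *v vector_derivative c (at t)))))"

text \<open>
  The value is arbitrary for points in different components.
\<close>

definition geodesic_dist :: "('p, 'i) surface \<Rightarrow> 'p \<Rightarrow> 'p \<Rightarrow> real" where
  "geodesic_dist S p q = Inf {l. curve_length S p q l}"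


section \<open>Green's functions and Robin functions\<close>

text \<open>
  \<open>\<Delta>u = T\<close> in the sense of distributions, where \<open>T\<close> is a functional on test functions. The
  Laplacian is formally self-adjoint with respect to the area measure.
\<close>

definition has_distr_laplacian ::
    "('p, 'i) surface \<Rightarrow> ('p \<Rightarrow> real) \<Rightarrow> (('p \<Rightarrow> real) \<Rightarrow> real) \<Rightarrow> bool" where
  "has_distr_laplacian S u T \<longleftrightarrow>
     (\<forall>K. compactin (topo S) K \<longrightarrow> set_integrable (area S) K u) \<and>
     (\<forall>\<phi>. test_fun S \<phi> \<longrightarrow>
        has_bochner_integral (area S) (\<lambda>p. u p * laplacian S \<phi> p) (T \<phi>))"

definition dirac :: "'p \<Rightarrow> ('p \<Rightarrow> real) \<Rightarrow> real" where
  "dirac q \<phi> = \<phi> q"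

definition green_source :: "('p, 'i) surface \<Rightarrow> 'p \<Rightarrow> ('p \<Rightarrow> real) \<Rightarrow> real" where
  "green_source S q \<phi> =
     (if compact_space (topo S)
      then dirac q \<phi> - (1 / measure (area S) (pts S)) * (\<integral>p. \<phi> p \<partial>area S)
      else dirac q \<phi>)"

definition smooth_off_diagonal :: "('p, 'i) surface \<Rightarrow> ('p \<Rightarrow> 'p \<Rightarrow> real) \<Rightarrow> bool" where
  "smooth_off_diagonal S G \<longleftrightarrow>
     (\<forall>i\<in>charts S. \<forall>j\<in>charts S.
        smooth_on {(x, y). x \<in> coord S i ` cdom S i \<and> y \<in> coord S j ` cdom S j \<and>
                           cinv S i x \<noteq> cinv S j y}
          (\<lambda>(x, y). G (cinv S i x) (cinv S j y)))"

text \<open>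
  A Green's function has no meaningful values on the diagonal: no condition below refers to
  \<open>G p p\<close>, since \<open>{q}\<close> is a null set for the area measure.
\<close>

definition green_function :: "('p, 'i) surface \<Rightarrow> ('p \<Rightarrow> 'p \<Rightarrow> real) \<Rightarrow> bool" where
  "green_function S G \<longleftrightarrow>
     (\<forall>p\<in>pts S. \<forall>q\<in>pts S. G p q = G q p) \<and>
     smooth_off_diagonal S G \<and>
     (\<forall>F. isometry S F \<longrightarrow> (\<forall>p\<in>pts S. \<forall>q\<in>pts S. p \<noteq> q \<longrightarrow> G (F p) (F q) = G p q)) \<and>
     (\<forall>q\<in>pts S. has_distr_laplacian S (\<lambda>p. G p q) (green_source S q))"

definition robin_function :: "('p, 'i) surface \<Rightarrow> ('p \<Rightarrow> 'p \<Rightarrow> real) \<Rightarrow> ('p \<Rightarrow> real) \<Rightarrow> bool" where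
  "robin_function S G R \<longleftrightarrow>
     (\<forall>p\<in>pts S.
        ((\<lambda>q. G p q - 1 / (2 * pi) * ln (geodesic_dist S p q)) \<longlongrightarrow> R p) (atin (topo S) p))"


section \<open>Orientations and the orientation double cover\<close>

text \<open>
  An orientation of the tangent plane at \<open>p\<close> is encoded by the function assigning to each chart
  around \<open>p\<close> the sign \<open>1\<close> or \<open>-1\<close> according to whether the coordinate frame of that chart at
  \<open>p\<close> is positively or negatively oriented (and \<open>0\<close> to all other indices).
\<close>

type_synonym 'i orientation = "'i \<Rightarrow> real"

definition orientations_at :: "('p, 'i) surface \<Rightarrow> 'p \<Rightarrow> 'i orientation set" where
  "orientations_at S p =
     {or. (\<forall>i. if i \<in> charts S \<and> p \<in> cdom S i then or i \<in> {1, -1} else or i = 0) \<and>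
          (\<forall>i\<in>charts S. \<forall>j\<in>charts S. p \<in> cdom S i \<inter> cdom S j \<longrightarrow>
             or j = sgn (det (jacobian (transition S i j) (coord S i p))) * or i)}"

text \<open>A surface is orientable if it has a continuous pointwise orientation.\<close>

definition orientable :: "('p, 'i) surface \<Rightarrow> bool" where
  "orientable S \<longleftrightarrow>
     (\<exists>\<omega>. (\<forall>p\<in>pts S. \<omega> p \<in> orientations_at S p) \<and>
          (\<forall>i\<in>charts S. \<forall>s\<in>{1, -1}. openin (topo S) {p \<in> cdom S i. \<omega> p i = s}))"

text \<open>
  The points over an open subset of \<open>cdom S i\<close> whose orientation takes a given sign in chart \<open>i\<close>
  form a basic open set. Each chart \<open>i\<close> of \<open>S\<close> yields the two charts \<open>(i, 1)\<close> and \<open>(i, -1)\<close>, in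
  which the projection is the identity; the metric is thus the lifted one.
\<close>

definition sheet ::
    "('p, 'i) surface \<Rightarrow> 'i \<Rightarrow> real \<Rightarrow> 'p set \<Rightarrow> ('p \<times> 'i orientation) set" where
  "sheet S i s V = {(p, or). p \<in> V \<and> or \<in> orientations_at S p \<and> or i = s}"

definition orientation_cover ::
    "('p, 'i) surface \<Rightarrow> ('p \<times> 'i orientation, 'i \<times> real) surface" where
  "orientation_cover S =
     \<lparr> topo = topology_generated_by
         {sheet S i s V | i s V. i \<in> charts S \<and> s \<in> {1, -1} \<and> openin (topo S) V \<and> V \<subseteq> cdom S i},
       charts = charts S \<times> {1, -1},
       cdom = (\<lambda>(i, s). sheet S i s (cdom S i)),
       coord = (\<lambda>(i, s). coord S i \<circ> fst),
       gram = (\<lambda>(i, s). gram S i) \<rparr>"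

definition proj :: "'p \<times> 'i orientation \<Rightarrow> 'p" where
  "proj = fst"

definition deck :: "'p \<times> 'i orientation \<Rightarrow> 'p \<times> 'i orientation" where
  "deck = (\<lambda>(p, or). (p, \<lambda>i. - or i))"

text \<open>
  Regular and twisted functions on \<open>M\<close>, as functions defined on a \<open>deck\<close>-invariant set \<open>A\<close> of
  points of the double cover.
\<close>

definition regular_on ::
    "('p \<times> 'i orientation) set \<Rightarrow> ('p \<times> 'i orientation \<Rightarrow> real) \<Rightarrow> bool" where
  "regular_on A f \<longleftrightarrow> (\<forall>x\<in>A. f (deck x) = f x)"

definition twisted_on ::
    "('p \<times> 'i orientation) set \<Rightarrow> ('p \<times> 'i orientation \<Rightarrow> real) \<Rightarrow> bool" where
  "twisted_on A f \<longleftrightarrow> (\<forall>x\<in>A. f (deck x) = - f x)"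

text \<open>\<open>G\<^sub>M\<close> and \<open>R\<^sub>M\<close>, as functions of the chosen lifts.\<close>

definition green_M ::
    "('p \<times> 'i orientation \<Rightarrow> 'p \<times> 'i orientation \<Rightarrow> real) \<Rightarrow>
     'p \<times> 'i orientation \<Rightarrow> 'p \<times> 'i orientation \<Rightarrow> real" where
  "green_M G x y = G x y - G x (deck y)"

definition robin_M ::
    "('p \<times> 'i orientation \<Rightarrow> 'p \<times> 'i orientation \<Rightarrow> real) \<Rightarrow>
     ('p \<times> 'i orientation \<Rightarrow> real) \<Rightarrow> 'p \<times> 'i orientation \<Rightarrow> real" where
  "robin_M G R x = R x - G x (deck x)"

end

theory Submission
  imports Defs
begin

text \<open>
  The deck involution \<open>\<tau>\<close> is an isometry of the cover, so \<open>G\<close> is invariant under it and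
  \<open>G(\<tau>x, y) = G(x, \<tau>y)\<close>; antisymmetry of \<open>G\<^sub>M\<close> in both arguments follows, and in the compact case the
  constants \<open>1/Area\<close> in the two sources cancel. A point \<open>y\<close> and \<open>\<tau>y\<close> lie in the disjoint sheets
  \<open>(i, s)\<close> and \<open>(i, -s)\<close> over any chart \<open>i\<close>, hence \<open>x \<mapsto> G(x, \<tau>y)\<close> is continuous at \<open>y\<close> and only
  shifts the limit that defines the Robin function. As \<open>\<tau>\<close> also preserves the geodesic distance, and
  limits at \<open>y\<close> are unique because \<open>y\<close> is not isolated, \<open>R \<circ> \<tau> = R\<close>.
\<close>


section \<open>Smooth maps between Euclidean spaces\<close>

text \<open>\<open>frechet_derivative\<close> is a choice among the admissible derivatives. Locally
  equal functions have the same admissible ones, so the choices coincide even at points without a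
  derivative.\<close>

lemma frechet_derivative_cong_open:
  assumes "open U" "x \<in> U" "\<And>y. y \<in> U \<Longrightarrow> f y = g y"
  shows "frechet_derivative f (at x) = frechet_derivative g (at x)"
proof -
  have "(f has_derivative D) (at x) \<longleftrightarrow> (g has_derivative D) (at x)" for D
    using assms by (metis has_derivative_transform_within_open)
  then show ?thesis
    by (simp add: frechet_derivative_def)
qed

text \<open>Derivatives at points of \<open>S\<close> see values outside \<open>S\<close>, hence the
  open set \<open>U\<close> around it. The induction varies \<open>f\<close> and \<open>g\<close>
  because it passes to their directional derivatives, which again agree on all of
  \<open>U\<close>.\<close>

lemma Ck_on_cong_open:
  assumes "open U" "S \<subseteq> U" "\<And>x. x \<in> U \<Longrightarrow> f x = g x" "Ck_on k S f"
  shows "Ck_on k S g"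
  using assms(3,4)
proof (induction k arbitrary: f g)
  case 0
  then show ?case
    using assms(2) by (auto cong: continuous_on_cong simp: subset_iff)
next
  case (Suc k)
  have "g differentiable (at x)" if "x \<in> S" for x
    using Suc.prems that assms(1,2)
    by (auto simp: differentiable_def) (meson has_derivative_transform_within_open subsetD)
  moreover have "Ck_on k S (\<lambda>x. frechet_derivative g (at x) v)" for v
  proof (rule Suc.IH)
    show "frechet_derivative f (at x) v = frechet_derivative g (at x) v" if "x \<in> U" for x
      using frechet_derivative_cong_open[OF assms(1) that Suc.prems(1)] by simp
    show "Ck_on k S (\<lambda>x. frechet_derivative f (at x) v)"
      using Suc.prems(2) by simp
  qed
  ultimately show ?case by simp
qed

lemma Ck_on_subset: "Ck_on k S f \<Longrightarrow> T \<subseteq> S \<Longrightarrow> Ck_on k T f"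
  by (induction k arbitrary: f) (auto intro: continuous_on_subset)

lemma smooth_on_cong_open:
  assumes "smooth_on S f" "T \<subseteq> S" "open U" "T \<subseteq> U" "\<And>x. x \<in> U \<Longrightarrow> f x = g x"
  shows "smooth_on T g"
  unfolding smooth_on_def
proof
  fix k
  have "Ck_on k T f"
    using assms(1,2) Ck_on_subset unfolding smooth_on_def by blast
  from Ck_on_cong_open[OF assms(3,4) _ this] assms(5) show "Ck_on k T g"
    by simp
qed

lemma smooth_on_imp_continuous_on: "smooth_on S f \<Longrightarrow> continuous_on S f"
  by (metis Ck_on.simps(1) smooth_on_def)

lemma smooth_on_imp_differentiable: "smooth_on S f \<Longrightarrow> x \<in> S \<Longrightarrow> f differentiable (at x)"
  by (metis Ck_on.simps(2) smooth_on_def)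

lemma jacobian_cong_open:
  assumes "open U" "x \<in> U" "\<And>y. y \<in> U \<Longrightarrow> f y = g y"
  shows "jacobian f x = jacobian g x"
  using frechet_derivative_cong_open[OF assms] by (simp add: jacobian_def)

lemma jacobian_compose:
  assumes "f differentiable (at x)" "g differentiable (at (f x))"
  shows "jacobian (g \<circ> f) x = jacobian g (f x) ** jacobian f x"
  using assms
  by (simp add: jacobian_def frechet_derivative_compose matrix_compose linear_frechet_derivative)

text \<open>The matrix entries are components of directional derivatives along basis vectors, and
  the determinant is a polynomial in them.\<close>

lemma continuous_on_det_jacobian:
  assumes "smooth_on S f"
  shows "continuous_on S (\<lambda>x. det (jacobian f x))"
proof -
  have "Ck_on (Suc 0) S f"
    using assms unfolding smooth_on_def by blast
  then have "continuous_on S (\<lambda>x. frechet_derivative f (at x) v)" for v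
    by simp
  then show ?thesis
    by (auto simp: det_2 jacobian_def matrix_def intro!: continuous_intros)
qed

lemma det_nonzero_of_pos_def:
  fixes A :: "real^'n^'n"
  assumes "\<And>v. v \<noteq> 0 \<Longrightarrow> v \<bullet> (A *v v) > 0"
  shows "det A \<noteq> 0"
proof -
  have "\<forall>v. A *v v = 0 \<longrightarrow> v = 0"
  proof (intro allI impI)
    fix v
    assume "A *v v = 0"
    then have "v \<bullet> (A *v v) = 0"
      by simp
    then show "v = 0"
      using assms[of v] by force
  qed
  then have "invertible A"
    by (simp add: invertible_left_inverse matrix_left_invertible_ker)
  then show ?thesis
    by (simp add: invertible_det_nz)
qed

lemma eventually_atin_neq: "\<forall>\<^sub>F x in atin X y. x \<in> topspace X \<and> y \<noteq> x"
  unfolding eventually_atin by blast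

section \<open>Reversing curves\<close>

text \<open>The substitution is an involution, so \<open>has_integral\<close> transfers in both
  directions. This covers non-integrable \<open>f\<close> too, where \<open>integral\<close> takes
  its default value on both sides.\<close>

lemma integral_flip_01:
  fixes f :: "real \<Rightarrow> real"
  shows "integral {0..1} (\<lambda>t. f (1 - t)) = integral {0..1} f"
proof -
  have flip: "((\<lambda>t. g (1 - t)) has_integral y) {0..1}" if "(g has_integral y) {0..1}"
    for g :: "real \<Rightarrow> real" and y
  proof -
    have "(\<lambda>x. 1 - x) ` {0..1} = {0..1::real}"
      by (auto simp: image_iff intro: bexI[of _ "1 - _"])
    then show ?thesis
      using has_integral_affinity01[OF that, of "- 1" 1] by simp
  qed
  have "((\<lambda>t. f (1 - t)) has_integral y) {0..1} \<longleftrightarrow> (f has_integral y) {0..1}" for y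
    using flip[of f y] flip[of "\<lambda>t. f (1 - t)" y] by auto
  then show ?thesis
    by (simp add: integral_def integrable_on_def)
qed

text \<open>Induction on the second curve, since \<open>curve_length\<close> grows at its end
  point.\<close>

lemma curve_length_trans:
  assumes "curve_length S q r l'" "curve_length S p q l"
  shows "curve_length S p r (l + l')"
  using assms
proof (induction rule: curve_length.induct)
  case (append_arc q r l' i c)
  show ?case
    using curve_length.append_arc[OF append_arc.IH[OF append_arc.prems] append_arc.hyps(2-6)]
    by (simp add: add.assoc)
qed simp

text \<open>The last arc is run backwards first, followed by the reversed rest of the curve.
  Symmetry of the distance, which results, is needed because \<open>robin_function\<close> puts the
  base point first and the limit of \<open>green_M\<close> puts the moving point first.\<close>

lemma curve_length_sym:
  assumes dom: "\<And>i. i \<in> charts S \<Longrightarrow> cdom S i \<subseteq> pts S"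
    and inj: "\<And>i. i \<in> charts S \<Longrightarrow> inj_on (coord S i) (cdom S i)"
    and "curve_length S p q l"
  shows "curve_length S q p l"
  using assms(3)
proof (induction rule: curve_length.induct)
  case (const p)
  then show ?case by (rule curve_length.const)
next
  case (append_arc p q l i c)
  define c' where "c' = (\<lambda>t. c (1 - t))"
  let ?speed = "\<lambda>c t. sqrt (vector_derivative c (at t) \<bullet>
                                      (gram S i (c t) *v vector_derivative c (at t)))"
  obtain D where D: "\<And>t. t \<in> {0..1} \<Longrightarrow> (c has_vector_derivative D t) (at t)"
      "continuous_on {0..1} D"
    using append_arc.hyps unfolding C1_differentiable_on_def by blast
  have D': "(c' has_vector_derivative - D (1 - t)) (at t)" if "t \<in> {0..1}" for t :: real
  proof -
    have "((\<lambda>t. 1 - t) has_vector_derivative - 1) (at t)"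
      by (auto intro!: derivative_eq_intros)
    moreover have "(c has_vector_derivative D (1 - t)) (at (1 - t))"
      using D(1) that by simp
    ultimately show ?thesis
      unfolding c'_def using vector_diff_chain_at[of "\<lambda>t. 1 - t" "- 1" t c "D (1 - t)"]
      by (simp add: o_def)
  qed
  have C1: "c' C1_differentiable_on {0..1}"
    unfolding C1_differentiable_on_def
  proof (intro exI conjI ballI)
    show "continuous_on {0..1} (\<lambda>t. - D (1 - t))"
      by (intro continuous_intros continuous_on_compose2[OF D(2)]) auto
  qed (rule D')
  let ?r = "cinv S i (c 1)"
  have c1: "c 1 \<in> coord S i ` cdom S i"
    using append_arc.hyps(5) by force
  then have r: "?r \<in> cdom S i" "coord S i ?r = c 1"
    unfolding cinv_def by (auto simp: inv_into_into f_inv_into_f)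
  have q: "cinv S i (c' 1) = q"
    unfolding cinv_def c'_def using append_arc.hyps inj by (simp add: inv_into_f_f)
  have "curve_length S ?r ?r 0"
    using r dom append_arc.hyps by (intro curve_length.const) blast
  from curve_length.append_arc[OF this append_arc.hyps(2) r(1) C1]
  have "curve_length S ?r q (0 + integral {0..1} (?speed c'))"
    unfolding q using append_arc.hyps(5) r(2) by (force simp: c'_def)
  moreover have "integral {0..1} (?speed c') = integral {0..1} (?speed c)"
  proof -
    have "?speed c' t = ?speed c (1 - t)" if "t \<in> {0..1}" for t
    proof -
      have "vector_derivative c' (at t) = - D (1 - t)"
        using D'[OF that] by (rule vector_derivative_at)
      moreover have "vector_derivative c (at (1 - t)) = D (1 - t)"
        using D(1) that by (intro vector_derivative_at) auto
      \<comment> \<open>Reversal negates the velocity. The sign passes through the Gram matrix, here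
        as a difference from \<open>0\<close>, and cancels in the quadratic form.\<close>
      ultimately show ?thesis
        using matrix_vector_mult_diff_distrib[of "gram S i (c (1 - t))" 0 "D (1 - t)"]
        by (simp add: c'_def)
    qed
    then have "integral {0..1} (?speed c') = integral {0..1} (\<lambda>t. ?speed c (1 - t))"
      by (intro integral_cong) auto
    also have "\<dots> = integral {0..1} (?speed c)"
      by (rule integral_flip_01)
    finally show ?thesis .
  qed
  ultimately have "curve_length S ?r q (integral {0..1} (?speed c))"
    by simp
  from curve_length_trans[OF append_arc.IH this] show ?case
    by (simp only: add.commute)
qed

lemma geodesic_dist_commute:
  assumes "\<And>i. i \<in> charts S \<Longrightarrow> cdom S i \<subseteq> pts S"
    and "\<And>i. i \<in> charts S \<Longrightarrow> inj_on (coord S i) (cdom S i)"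
  shows "geodesic_dist S p q = geodesic_dist S q p"
proof -
  have "curve_length S p q = curve_length S q p"
    using curve_length_sym[OF assms] by (intro ext iffI) blast+
  then show ?thesis
    by (simp add: geodesic_dist_def)
qed

section \<open>The orientation double cover\<close>

lemma deck_deck [simp]: "deck (deck x) = x"
  by (simp add: deck_def split_beta)

lemma proj_deck [simp]: "proj (deck x) = proj x"
  by (simp add: deck_def proj_def split_beta)

text \<open>The cocycle with values in the signs that defines the orientation cover. It is the
  factor in the compatibility condition of \<open>orientations_at\<close>.\<close>

definition tsign :: "('p, 'i) surface \<Rightarrow> 'i \<Rightarrow> 'i \<Rightarrow> 'p \<Rightarrow> real" where
  "tsign S i j p = sgn (det (jacobian (transition S i j) (coord S i p)))"

text \<open>The orientation at \<open>p\<close> that has sign \<open>s\<close> in chart \<open>i\<close>; meaningful only for \<open>p \<in> cdom S i\<close>.\<close>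

definition orient :: "('p, 'i) surface \<Rightarrow> 'i \<Rightarrow> real \<Rightarrow> 'p \<Rightarrow> 'i orientation" where
  "orient S i s p = (\<lambda>j. if j \<in> charts S \<and> p \<in> cdom S j then s * tsign S i j p else 0)"

lemma deck_orient [simp]: "deck (p, orient S i s p) = (p, orient S i (- s) p)"
  by (auto simp: deck_def orient_def)

lemma orientation_cover_simps [simp]:
  "charts (orientation_cover S) = charts S \<times> {1, -1}"
  "cdom (orientation_cover S) (i, s) = sheet S i s (cdom S i)"
  "coord (orientation_cover S) (i, s) = coord S i \<circ> fst"
  "gram (orientation_cover S) (i, s) = gram S i"
  by (simp_all add: orientation_cover_def)

context
  fixes M :: "('p, 'i) surface"
  assumes M: "riemannian_surface M"
begin

section \<open>Charts and transition maps of the base surface\<close>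

lemma cdom_open: "i \<in> charts M \<Longrightarrow> openin (topo M) (cdom M i)"
  using M by (simp add: riemannian_surface_def)

lemma coord_homeo: "i \<in> charts M \<Longrightarrow>
    homeomorphic_map (subtopology (topo M) (cdom M i)) (top_of_set (coord M i ` cdom M i)) (coord M i)"
  using M by (simp add: riemannian_surface_def)

lemma coord_range_open: "i \<in> charts M \<Longrightarrow> open (coord M i ` cdom M i)"
  using M by (simp add: riemannian_surface_def)

lemma transition_smooth: "i \<in> charts M \<Longrightarrow> j \<in> charts M \<Longrightarrow>
    smooth_on (coord M i ` (cdom M i \<inter> cdom M j)) (transition M i j)"
  using M by (simp add: riemannian_surface_def)

lemma gram_pos:
  "i \<in> charts M \<Longrightarrow> x \<in> coord M i ` cdom M i \<Longrightarrow> v \<noteq> 0 \<Longrightarrow> v \<bullet> (gram M i x *v v) > 0"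
  using M unfolding riemannian_surface_def by blast

lemma gram_transition:
  "i \<in> charts M \<Longrightarrow> j \<in> charts M \<Longrightarrow> x \<in> coord M i ` (cdom M i \<inter> cdom M j) \<Longrightarrow>
    gram M i x = transpose (jacobian (transition M i j) x) ** gram M j (transition M i j x)
      ** jacobian (transition M i j) x"
  using M unfolding riemannian_surface_def by blast

lemma cdom_subset: "i \<in> charts M \<Longrightarrow> cdom M i \<subseteq> pts M"
  by (simp add: cdom_open openin_subset)

lemma coord_inj: "i \<in> charts M \<Longrightarrow> inj_on (coord M i) (cdom M i)"
  using homeomorphic_imp_injective_map[OF coord_homeo] cdom_subset
  by (simp add: Int_absorb1)

lemma cinv_coord: "i \<in> charts M \<Longrightarrow> p \<in> cdom M i \<Longrightarrow> cinv M i (coord M i p) = p"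
  by (simp add: cinv_def coord_inj)

lemma transition_coord:
  "i \<in> charts M \<Longrightarrow> p \<in> cdom M i \<Longrightarrow> transition M i j (coord M i p) = coord M j p"
  by (simp add: transition_def cinv_coord)

lemma coord_image_open:
  assumes "i \<in> charts M" "openin (topo M) V" "V \<subseteq> cdom M i"
  shows "open (coord M i ` V)"
proof -
  have "openin (top_of_set (coord M i ` cdom M i)) (coord M i ` V)"
    using homeomorphic_map_openness[OF coord_homeo[OF assms(1)], of V] assms cdom_subset[OF assms(1)]
    by (auto simp: openin_open_subtopology openin_subtopology_alt cdom_open openin_subset)
  then show ?thesis
    using coord_range_open[OF assms(1)] openin_open_eq by blast
qed

lemma coord_vimage_open:
  assumes "i \<in> charts M" "open U"
  shows "openin (topo M) {p \<in> cdom M i. coord M i p \<in> U}"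
proof -
  have "continuous_map (subtopology (topo M) (cdom M i)) euclidean (coord M i)"
    using homeomorphic_imp_continuous_map[OF coord_homeo[OF assms(1)]]
    by (simp add: continuous_map_in_subtopology)
  then have "openin (subtopology (topo M) (cdom M i))
      {p \<in> topspace (subtopology (topo M) (cdom M i)). coord M i p \<in> U}"
    using assms(2) by (intro openin_continuous_map_preimage) auto
  then show ?thesis
    using cdom_subset[OF assms(1)] cdom_open[OF assms(1)]
    by (simp add: Int_absorb1 openin_open_subtopology)
qed

lemma overlap_open:
  "i \<in> charts M \<Longrightarrow> j \<in> charts M \<Longrightarrow> open (coord M i ` (cdom M i \<inter> cdom M j))"
  by (intro coord_image_open openin_Int cdom_open) auto

text \<open>By the transformation law of the metric, a singular Jacobian would make the Gram matrix
  singular, against its positive definiteness.\<close>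

lemma det_transition_nonzero:
  assumes "i \<in> charts M" "j \<in> charts M" "x \<in> coord M i ` (cdom M i \<inter> cdom M j)"
  shows "det (jacobian (transition M i j) x) \<noteq> 0"
proof
  assume "det (jacobian (transition M i j) x) = 0"
  then have "det (gram M i x) = 0"
    using gram_transition[OF assms] by (simp add: det_mul)
  then show False
    using det_nonzero_of_pos_def[OF gram_pos] assms by blast
qed

section \<open>The sign cocycle and the two orientations at a point\<close>

lemma tsign_cases:
  assumes "i \<in> charts M" "j \<in> charts M" "p \<in> cdom M i" "p \<in> cdom M j"
  shows "tsign M i j p \<in> {1, -1}"
  using det_transition_nonzero[OF assms(1,2), of "coord M i p"] assms
  by (auto simp: tsign_def sgn_if)

text \<open>Chain rule for the transition maps, together with multiplicativity of \<open>det\<close>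
  and \<open>sgn\<close>.\<close>

lemma tsign_cocycle:
  assumes "i \<in> charts M" "j \<in> charts M" "k \<in> charts M"
    and "p \<in> cdom M i" "p \<in> cdom M j" "p \<in> cdom M k"
  shows "tsign M i k p = tsign M j k p * tsign M i j p"
proof -
  let ?U = "coord M i ` (cdom M i \<inter> cdom M j)"
  \<comment> \<open>The two maps agree on the whole open set \<open>?U\<close>, even at points
    outside \<open>cdom M k\<close>, since both send \<open>coord M i q\<close> to
    \<open>coord M k q\<close>.\<close>
  have "jacobian (transition M i k) (coord M i p)
      = jacobian (transition M j k \<circ> transition M i j) (coord M i p)"
    using assms by (intro jacobian_cong_open[of ?U] overlap_open) (auto simp: transition_coord)
  also have "\<dots> = jacobian (transition M j k) (coord M j p)
      ** jacobian (transition M i j) (coord M i p)"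
    using assms
    by (subst jacobian_compose)
      (auto simp: transition_coord intro!: smooth_on_imp_differentiable[OF transition_smooth])
  finally show ?thesis
    by (simp add: tsign_def det_mul sgn_mult)
qed

text \<open>The cocycle rule makes the value equal to its own square, and the square of a sign is
  \<open>1\<close>.\<close>

lemma tsign_self:
  assumes "i \<in> charts M" "p \<in> cdom M i"
  shows "tsign M i i p = 1"
proof -
  have "tsign M i i p * tsign M i i p = 1"
    using tsign_cases[of i i p] assms by auto
  then show ?thesis
    using tsign_cocycle[of i i i p] assms by metis
qed

text \<open>The compatibility of the signs in two charts \<open>j\<close> and \<open>k\<close> is
  the cocycle rule for \<open>i\<close>, \<open>j\<close>, \<open>k\<close>.\<close>

lemma orient_in_orientations:
  assumes "i \<in> charts M" "p \<in> cdom M i" "s \<in> {1, -1}"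
  shows "orient M i s p \<in> orientations_at M p"
proof -
  have "s * tsign M i j p \<in> {1, -1}" if "j \<in> charts M" "p \<in> cdom M j" for j
    using tsign_cases[of i j p] that assms by auto
  then have "if j \<in> charts M \<and> p \<in> cdom M j then orient M i s p j \<in> {1, -1}
      else orient M i s p j = 0" for j
    by (simp add: orient_def)
  moreover have "orient M i s p k
      = sgn (det (jacobian (transition M j k) (coord M j p))) * orient M i s p j"
    if "j \<in> charts M" "k \<in> charts M" "p \<in> cdom M j \<inter> cdom M k" for j k
  proof -
    have "s * tsign M i k p = tsign M j k p * (s * tsign M i j p)"
      using tsign_cocycle[of i j k p] that assms by simp
    then show ?thesis
      using that by (simp add: orient_def tsign_def)
  qed
  ultimately show ?thesis
    unfolding orientations_at_def by blast
qed

lemma orient_self: "i \<in> charts M \<Longrightarrow> p \<in> cdom M i \<Longrightarrow> orient M i s p i = s"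
  by (simp add: orient_def tsign_self)

lemma orientation_value:
  assumes "\<theta> \<in> orientations_at M p"
  shows "if i \<in> charts M \<and> p \<in> cdom M i then \<theta> i \<in> {1, -1} else \<theta> i = 0"
  using assms unfolding orientations_at_def by blast

lemma orientation_transition:
  assumes "\<theta> \<in> orientations_at M p" "i \<in> charts M" "j \<in> charts M" "p \<in> cdom M i" "p \<in> cdom M j"
  shows "\<theta> j = tsign M i j p * \<theta> i"
  using assms unfolding orientations_at_def tsign_def by blast

lemma orientation_sign:
  "\<theta> \<in> orientations_at M p \<Longrightarrow> i \<in> charts M \<Longrightarrow> p \<in> cdom M i \<Longrightarrow> \<theta> i \<in> {1, -1}"
  using orientation_value[of \<theta> p i] by simp

text \<open>The sign in one chart determines the signs in all others through the transition rule. So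
  a fibre has only two candidates, one for each sign in chart \<open>i\<close>.\<close>

lemma orientation_eq_orient:
  assumes "i \<in> charts M" "p \<in> cdom M i" "\<theta> \<in> orientations_at M p"
  shows "\<theta> = orient M i (\<theta> i) p"
proof
  fix j
  show "\<theta> j = orient M i (\<theta> i) p j"
  proof (cases "j \<in> charts M \<and> p \<in> cdom M j")
    case True
    then have "\<theta> j = tsign M i j p * \<theta> i"
      using orientation_transition assms by blast
    with True show ?thesis
      by (simp add: orient_def)
  next
    case False
    then show ?thesis
      using orientation_value[OF assms(3), of j] by (auto simp: orient_def)
  qed
qed

text \<open>Each point of \<open>V\<close> has exactly one orientation of sign \<open>s\<close> in
  chart \<open>i\<close>, so the sheet is the image of a section. Most later computations on the
  cover use this form.\<close>

lemma sheet_eq: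
  assumes "i \<in> charts M" "V \<subseteq> cdom M i" "s \<in> {1, -1}"
  shows "sheet M i s V = (\<lambda>p. (p, orient M i s p)) ` V"
proof (intro subset_antisym subsetI)
  fix x
  assume "x \<in> sheet M i s V"
  then obtain p \<theta> where x: "x = (p, \<theta>)" "p \<in> V" "\<theta> \<in> orientations_at M p" "\<theta> i = s"
    unfolding sheet_def by blast
  have "\<theta> = orient M i (\<theta> i) p"
    using orientation_eq_orient assms(1,2) x by blast
  then show "x \<in> (\<lambda>p. (p, orient M i s p)) ` V"
    unfolding \<open>\<theta> i = s\<close> using x(1,2) by blast
next
  fix x
  assume "x \<in> (\<lambda>p. (p, orient M i s p)) ` V"
  then obtain p where x: "x = (p, orient M i s p)" "p \<in> V"
    by blast
  then show "x \<in> sheet M i s V"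
    using orient_in_orientations[OF assms(1) _ assms(3)] orient_self[OF assms(1)] assms(2)
    unfolding sheet_def by blast
qed

section \<open>Points, fibres and charts of the cover\<close>

abbreviation "C \<equiv> orientation_cover M"

abbreviation "sheets \<equiv>
  {sheet M i s V | i s V. i \<in> charts M \<and> s \<in> {1, -1} \<and> openin (topo M) V \<and> V \<subseteq> cdom M i}"

lemma topo_cover: "topo C = topology_generated_by sheets"
  by (simp add: orientation_cover_def)

lemma pts_cover: "pts C = \<Union> sheets"
  by (simp only: topo_cover topology_generated_by_topspace)

lemma openin_sheet:
  assumes "i \<in> charts M" "s \<in> {1, -1}" "openin (topo M) V" "V \<subseteq> cdom M i"
  shows "openin (topo C) (sheet M i s V)"
  using assms unfolding orientation_cover_def by (auto intro!: topology_generated_by_Basis)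

lemma cover_point_cases:
  assumes "y \<in> pts C"
  obtains i s p where "i \<in> charts M" "s \<in> {1, -1}" "p \<in> cdom M i" "y = (p, orient M i s p)"
proof -
  from assms obtain i s V where "i \<in> charts M" "s \<in> {1, -1}" "V \<subseteq> cdom M i" "y \<in> sheet M i s V"
    unfolding orientation_cover_def by (auto simp: topology_generated_by_topspace)
  then show thesis
    using that sheet_eq[of i V s] by blast
qed

lemma cover_pointI:
  assumes "i \<in> charts M" "s \<in> {1, -1}" "p \<in> cdom M i"
  shows "(p, orient M i s p) \<in> pts C"
proof -
  have "(p, orient M i s p) \<in> sheet M i s (cdom M i)"
    unfolding sheet_eq[OF assms(1) order_refl assms(2)] using assms(3) by blast
  then show ?thesis
    using openin_subset[OF openin_sheet[OF assms(1,2) cdom_open[OF assms(1)] order_refl]] by blast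
qed

lemma deck_pts: "y \<in> pts C \<Longrightarrow> deck y \<in> pts C"
  by (elim cover_point_cases) (use cover_pointI in auto)

text \<open>The two points may be given in different charts. Read in the chart \<open>i\<close> of
  \<open>y\<close>, the orientation of \<open>z\<close> has sign \<open>s\<close> or
  \<open>- s\<close>, and these two signs give \<open>y\<close> and \<open>deck y\<close>.\<close>

lemma fibre:
  assumes "y \<in> pts C" "z \<in> pts C" "proj y = proj z"
  shows "z = y \<or> z = deck y"
  using assms(1)
proof (cases rule: cover_point_cases)
  case (1 i s p)
  obtain j t p' where j: "j \<in> charts M" "t \<in> {1, -1}" "p' \<in> cdom M j" "z = (p', orient M j t p')"
    using assms(2) by (rule cover_point_cases)
  have "p' = p"
    using assms(3) 1(4) j(4) by (simp add: proj_def)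
  note j = j[unfolded this]
  define \<theta> where "\<theta> = orient M j t p"
  have \<theta>: "\<theta> \<in> orientations_at M p"
    unfolding \<theta>_def using orient_in_orientations j by blast
  have "\<theta> i = s \<or> \<theta> i = - s"
    using orientation_sign[OF \<theta> 1(1,3)] 1(2) by auto
  moreover have "z = (p, orient M i (\<theta> i) p)"
    using orientation_eq_orient[OF 1(1,3) \<theta>] j(4) unfolding \<theta>_def by metis
  ultimately show ?thesis
    unfolding 1(4) deck_orient by (elim disjE) simp_all
qed

lemma cover_coord_inj:
  assumes "i \<in> charts M" "s \<in> {1, -1}"
  shows "inj_on (coord C (i, s)) (cdom C (i, s))"
  using coord_inj[OF assms(1)] assms by (auto simp: sheet_eq inj_on_def)

text \<open>The coordinate map of the chart \<open>(i, s)\<close> forgets the orientation;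
  restricted to the sheet it is injective, so its inverse restores the orientation of sign
  \<open>s\<close>.\<close>

lemma cover_cinv:
  assumes "i \<in> charts M" "s \<in> {1, -1}" "p \<in> cdom M i"
  shows "cinv C (i, s) (coord M i p) = (p, orient M i s p)"
proof -
  have "(p, orient M i s p) \<in> cdom C (i, s)"
    using assms by (auto simp: sheet_eq)
  then show ?thesis
    using inv_into_f_f[OF cover_coord_inj[OF assms(1,2)]] unfolding cinv_def by force
qed

section \<open>The deck involution as an isometry\<close>

lemma uminus_orientation:
  assumes "\<theta> \<in> orientations_at M p"
  shows "(\<lambda>i. - \<theta> i) \<in> orientations_at M p"
  unfolding orientations_at_def mem_Collect_eq
proof (intro conjI allI ballI impI)
  fix i
  show "if i \<in> charts M \<and> p \<in> cdom M i then - \<theta> i \<in> {1, -1} else - \<theta> i = 0"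
    using orientation_value[OF assms, of i] by (auto split: if_splits)
next
  fix i j
  assume "i \<in> charts M" "j \<in> charts M" "p \<in> cdom M i \<inter> cdom M j"
  then have "\<theta> j = tsign M i j p * \<theta> i"
    using orientation_transition[OF assms] by blast
  then show "- \<theta> j = sgn (det (jacobian (transition M i j) (coord M i p))) * - \<theta> i"
    by (simp add: tsign_def)
qed

lemma deck_vimage_sheet: "deck -` sheet M i s V = sheet M i (- s) V"
proof -
  have "(\<lambda>i. - \<theta> i) \<in> orientations_at M p \<longleftrightarrow> \<theta> \<in> orientations_at M p" for \<theta> p
    using uminus_orientation[of \<theta> p] uminus_orientation[of "\<lambda>i. - \<theta> i" p] by auto
  then show ?thesis
    by (auto simp: sheet_def deck_def minus_equation_iff equation_minus_iff)
qed

text \<open>Continuity is tested on the generating sheets, and the preimage of a sheet is the sheet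
  of opposite sign over the same \<open>V\<close>.\<close>

lemma deck_continuous: "continuous_map (topo C) (topo C) deck"
proof -
  have "continuous_map (topo C) (topology_generated_by sheets) deck"
  proof (rule continuous_on_generated_topo)
    fix U
    assume "U \<in> sheets"
    then obtain i s V where U: "U = sheet M i s V" "i \<in> charts M" "s \<in> {1, -1}"
        "openin (topo M) V" "V \<subseteq> cdom M i"
      by blast
    then have "openin (topo C) (deck -` U)"
      unfolding U(1) deck_vimage_sheet by (intro openin_sheet) auto
    then show "openin (topo C) (deck -` U \<inter> topspace (topo C))"
      by (intro openin_Int openin_topspace)
  next
    show "deck ` topspace (topo C) \<subseteq> \<Union> sheets"
      unfolding pts_cover[symmetric] using deck_pts by blast
  qed
  then show ?thesis
    by (simp only: topo_cover)
qed

lemma deck_homeomorphic: "homeomorphic_map (topo C) (topo C) deck"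
  by (rule homeomorphic_maps_imp_map[of _ _ _ deck])
    (simp add: homeomorphic_maps_def deck_continuous)

text \<open>Cover coordinates ignore the orientation, so in charts the involution is a transition
  map of \<open>M\<close>. Smoothness and the metric identity are then the compatibility conditions
  of the atlas of \<open>M\<close>.\<close>

lemma deck_isometry: "isometry C deck"
proof -
  have chart: "smooth_on W F' \<and> (\<forall>x\<in>W. gram M i x =
        transpose (jacobian F' x) ** gram M j (F' x) ** jacobian F' x)"
    if i: "i \<in> charts M" "s \<in> {1, -1}" and j: "j \<in> charts M" "t \<in> {1, -1}"
      and W: "W = coord C (i, s) ` {p \<in> cdom C (i, s). deck p \<in> cdom C (j, t)}"
      and F': "F' = coord C (j, t) \<circ> deck \<circ> cinv C (i, s)" for i s j t W F'
  proof -
    let ?U = "coord M i ` cdom M i"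
    \<comment> \<open>The agreement holds on the full open chart range and thus carries smoothness
      and Jacobians over to \<open>W\<close>, which is only shown to lie inside the overlap of the
      charts.\<close>
    have eq: "transition M i j x = F' x" if "x \<in> ?U" for x
      using that i unfolding F' by (auto simp: cover_cinv transition_coord)
    have W_sub: "W \<subseteq> coord M i ` (cdom M i \<inter> cdom M j)"
      unfolding W using i j by (auto simp: sheet_eq)
    then have W_U: "W \<subseteq> ?U"
      by blast
    have U: "open ?U"
      using coord_range_open i by blast
    have "smooth_on W F'"
      by (rule smooth_on_cong_open[OF transition_smooth[OF i(1) j(1)] W_sub U W_U eq])
    moreover have "gram M i x = transpose (jacobian F' x) ** gram M j (F' x) ** jacobian F' x"
      if "x \<in> W" for x
      using gram_transition[OF i(1) j(1), of x] jacobian_cong_open[OF U, of x, OF _ eq] eq[of x]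
        that W_U W_sub by auto
    ultimately show ?thesis by blast
  qed
  have "let W = coord C k ` {p \<in> cdom C k. deck p \<in> cdom C l};
             F' = coord C l \<circ> deck \<circ> cinv C k
         in smooth_on W F' \<and>
            (\<forall>x\<in>W. gram C k x =
               transpose (jacobian F' x) ** gram C l (F' x) ** jacobian F' x)"
    if "k \<in> charts C" "l \<in> charts C" for k l
  proof -
    from that obtain i s j t where k: "k = (i, s)" "i \<in> charts M" "s \<in> {1, -1}"
        and l: "l = (j, t)" "j \<in> charts M" "t \<in> {1, -1}"
      unfolding orientation_cover_simps(1) by (elim SigmaE)
    show ?thesis
      unfolding k(1) l(1) Let_def orientation_cover_simps(4)
      by (rule chart[OF k(2,3) l(2,3) refl refl])
  qed
  then show ?thesis
    unfolding isometry_def using deck_homeomorphic by blast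
qed

section \<open>Inverse charts of the cover and absence of isolated points\<close>

lemma cover_cinv_continuous:
  assumes "i \<in> charts M" "s \<in> {1, -1}"
  shows "continuous_map (top_of_set (coord M i ` cdom M i)) (topo C) (cinv C (i, s))"
proof -
  let ?U = "coord M i ` cdom M i"
  have "continuous_map (top_of_set ?U) (topology_generated_by sheets)
      (cinv C (i, s))"
  proof (rule continuous_on_generated_topo)
    fix W
    assume "W \<in> sheets"
    then obtain j t V where W: "W = sheet M j t V" and j: "j \<in> charts M" "t \<in> {1, -1}"
        "openin (topo M) V" "V \<subseteq> cdom M j"
      by blast
    \<comment> \<open>The point over \<open>p\<close> with sign \<open>s\<close> in chart
      \<open>i\<close> has sign \<open>t\<close> in chart \<open>j\<close> exactly when
      \<open>?d\<close> is positive at its coordinates: \<open>s\<close> and \<open>t\<close> are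
      signs and the determinant does not vanish. Continuity of the determinant makes this an open
      condition.\<close>
    let ?d = "\<lambda>x. s * t * det (jacobian (transition M i j) x)"
    let ?O = "coord M i ` (cdom M i \<inter> V)"
    have "cinv C (i, s) (coord M i p) \<in> W \<longleftrightarrow> coord M i p \<in> ?O \<inter> ?d -` {0<..}"
      if p: "p \<in> cdom M i" for p
    proof -
      have "cinv C (i, s) (coord M i p) \<in> W \<longleftrightarrow> p \<in> V \<and> orient M i s p j = t"
        using p assms orient_in_orientations by (auto simp: cover_cinv W sheet_def)
      also have "\<dots> \<longleftrightarrow> p \<in> V \<and> ?d (coord M i p) > 0"
        using assms j p det_transition_nonzero[of i j "coord M i p"]
        by (auto simp: orient_def tsign_def sgn_if)
      also have "\<dots> \<longleftrightarrow> coord M i p \<in> ?O \<inter> ?d -` {0<..}"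
        using p coord_inj[OF assms(1)] by (auto simp: inj_on_def)
      finally show ?thesis .
    qed
    then have "cinv C (i, s) -` W \<inter> ?U = ?O \<inter> ?d -` {0<..}"
      by blast
    moreover have "open (?O \<inter> ?d -` {0<..})"
    proof (rule continuous_open_preimage)
      show "continuous_on ?O ?d"
        using j by (intro continuous_intros continuous_on_subset[OF
              continuous_on_det_jacobian[OF transition_smooth[OF assms(1) j(1)]]]) auto
      show "open ?O"
        using assms j by (intro coord_image_open openin_Int cdom_open) auto
    qed simp
    ultimately show "openin (top_of_set ?U) (cinv C (i, s) -` W \<inter> topspace (top_of_set ?U))"
      by (metis Int_lower2 coord_range_open assms(1) openin_open_eq topspace_euclidean_subtopology)
  next
    have "cinv C (i, s) ` ?U \<subseteq> pts C"
      using assms cover_pointI by (auto simp: cover_cinv)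
    then show "cinv C (i, s) ` topspace (top_of_set ?U) \<subseteq> \<Union> sheets"
      by (simp only: pts_cover topspace_euclidean_subtopology)
  qed
  then show ?thesis
    by (simp only: topo_cover)
qed

text \<open>An isolated point would pull back along the continuous inverse chart to an open
  singleton in the plane. This gives uniqueness of the limits defining the Robin function.\<close>

lemma atin_cover_nontrivial:
  assumes "y \<in> pts C"
  shows "atin (topo C) y \<noteq> bot"
proof
  assume bot: "atin (topo C) y = bot"
  from assms obtain i s p where i: "i \<in> charts M" "s \<in> {1, -1}" and p: "p \<in> cdom M i"
      and y: "y = (p, orient M i s p)"
    by (rule cover_point_cases)
  have "eventually (\<lambda>_. False) (atin (topo C) y)"
    using bot by simp
  then obtain U where U: "openin (topo C) U" "y \<in> U" "U - {y} = {}"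
    using assms unfolding eventually_atin by blast
  then have "U = {y}"
    by blast
  let ?U = "coord M i ` cdom M i"
  have "openin (top_of_set ?U) {x \<in> ?U. cinv C (i, s) x \<in> U}"
    using openin_continuous_map_preimage[OF cover_cinv_continuous[OF i] U(1)] by simp
  then have "open {x \<in> ?U. cinv C (i, s) x \<in> U}"
    using coord_range_open[OF i(1)] openin_open_eq by blast
  also have "{x \<in> ?U. cinv C (i, s) x \<in> U} = {coord M i p}"
    unfolding \<open>U = {y}\<close> y using i p by (auto simp: cover_cinv)
  finally show False
    using not_open_singleton by blast
qed

section \<open>Limits, curves and distances under the deck involution\<close>

lemma cover_coord_tendsto:
  assumes "i \<in> charts M" "s \<in> {1, -1}" "p \<in> cdom M i"
  shows "((\<lambda>x. coord M i (fst x)) \<longlongrightarrow> coord M i p) (atin (topo C) (p, orient M i s p))"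
proof (rule topological_tendstoI)
  fix U :: "(real^2) set"
  assume U: "open U" "coord M i p \<in> U"
  let ?V = "{p \<in> cdom M i. coord M i p \<in> U}"
  have "openin (topo C) (sheet M i s ?V)"
    by (intro openin_sheet coord_vimage_open assms U) auto
  moreover have "sheet M i s ?V = (\<lambda>p. (p, orient M i s p)) ` ?V"
    using assms by (intro sheet_eq) auto
  ultimately show "\<forall>\<^sub>F x in atin (topo C) (p, orient M i s p). coord M i (fst x) \<in> U"
    unfolding eventually_atin using assms(3) U(2) by (intro disjI2 exI[of _ "sheet M i s ?V"]) auto
qed

text \<open>An arc in the chart \<open>(i, s)\<close> goes to the arc with the same coordinate curve
  \<open>c\<close> in the chart \<open>(i, - s)\<close>. Both charts have the same Gram matrices, so
  the length is unchanged.\<close>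

lemma curve_length_deck:
  assumes "curve_length C p q l"
  shows "curve_length C (deck p) (deck q) l"
  using assms
proof (induction rule: curve_length.induct)
  case (const p)
  then show ?case by (intro curve_length.const deck_pts)
next
  case (append_arc p q l k c)
  obtain i s where k: "k = (i, s)" "i \<in> charts M" "s \<in> {1, -1}"
    using append_arc.hyps by auto
  have k': "(i, - s) \<in> charts C" "- s \<in> {1, -1}"
    using k by auto
  have im: "coord C (i, t) ` cdom C (i, t) = coord M i ` cdom M i" if "t \<in> {1, -1}" for t
    using that k by (auto simp: sheet_eq image_iff)
  have q: "deck q \<in> cdom C (i, - s)" "coord C (i, - s) (deck q) = coord C k q"
    using append_arc.hyps k k'(2) by (auto simp: sheet_eq)
  have "c 1 \<in> coord C k ` cdom C k"
    using append_arc.hyps by force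
  then have "c 1 \<in> coord M i ` cdom M i"
    using im[OF k(3)] k(1) by blast
  then have r: "deck (cinv C k (c 1)) = cinv C (i, - s) (c 1)"
    using k k'(2) by (auto simp: cover_cinv)
  show ?case
    using curve_length.append_arc[OF append_arc.IH k'(1) q(1) append_arc.hyps(4)]
      append_arc.hyps(5,6) q(2) im[OF k(3)] im[OF k'(2)] k(1)
    by (simp add: r[unfolded k(1)])
qed

lemma geodesic_dist_deck: "geodesic_dist C (deck p) (deck q) = geodesic_dist C p q"
proof -
  have "curve_length C (deck p) (deck q) l \<longleftrightarrow> curve_length C p q l" for l
    using curve_length_deck[of p q l] curve_length_deck[of "deck p" "deck q" l] by auto
  then show ?thesis
    by (simp add: geodesic_dist_def)
qed

lemma cover_geodesic_dist_commute: "geodesic_dist C p q = geodesic_dist C q p"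
proof (rule geodesic_dist_commute)
  fix k
  assume "k \<in> charts C"
  then obtain i s where k: "k = (i, s)" "i \<in> charts M" "s \<in> {1, -1}"
    by auto
  show "cdom C k \<subseteq> pts C"
    unfolding k(1) orientation_cover_simps(2)
    by (rule openin_subset[OF openin_sheet[OF k(2,3) cdom_open[OF k(2)] order_refl]])
  show "inj_on (coord C k) (cdom C k)"
    unfolding k(1) by (rule cover_coord_inj[OF k(2,3)])
qed

text \<open>Continuity moves neighbourhoods, and injectivity keeps them punctured: \<open>x\<close>
  different from \<open>y\<close> gives \<open>deck x\<close> different from
  \<open>deck y\<close>.\<close>

lemma deck_filterlim:
  assumes "y \<in> pts C"
  shows "filterlim deck (atin (topo C) (deck y)) (atin (topo C) y)"
  unfolding filterlim_iff
proof (intro allI impI)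
  fix P
  assume "eventually P (atin (topo C) (deck y))"
  then obtain U where U: "openin (topo C) U" "deck y \<in> U" "\<And>x. x \<in> U - {deck y} \<Longrightarrow> P x"
    using deck_pts[OF assms] by (auto simp: eventually_atin)
  have "openin (topo C) {x \<in> pts C. deck x \<in> U}"
    using openin_continuous_map_preimage[OF deck_continuous U(1)] .
  moreover have "P (deck x)" if "x \<in> {x \<in> pts C. deck x \<in> U} - {y}" for x
    using that U(3)[of "deck x"] by (metis (mono_tags, lifting)
        Diff_iff deck_deck mem_Collect_eq singletonD singletonI)
  ultimately show "\<forall>\<^sub>F x in atin (topo C) y. P (deck x)"
    unfolding eventually_atin using assms U(2)
    by (intro disjI2 exI[of _ "{x \<in> pts C. deck x \<in> U}"]) auto
qed

section \<open>Green's functions and Robin functions on the cover\<close>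

context
  fixes G R
  assumes G: "green_function C G" and R: "robin_function C G R"
begin

lemma green_sym: "p \<in> pts C \<Longrightarrow> q \<in> pts C \<Longrightarrow> G p q = G q p"
  using G by (simp add: green_function_def)

lemma green_deck: "p \<in> pts C \<Longrightarrow> q \<in> pts C \<Longrightarrow> p \<noteq> q \<Longrightarrow> G (deck p) (deck q) = G p q"
  using G deck_isometry by (simp add: green_function_def)

lemma robin_tendsto: "p \<in> pts C \<Longrightarrow>
    ((\<lambda>q. G p q - 1 / (2 * pi) * ln (geodesic_dist C p q)) \<longlongrightarrow> R p) (atin (topo C) p)"
  using R by (simp add: robin_function_def)

text \<open>The limit at \<open>deck y\<close>, pulled back along the involution, is the limit of
  the same expression at \<open>y\<close>, because \<open>G\<close> off the diagonal and the
  distance are invariant.\<close>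

lemma robin_deck:
  assumes "y \<in> pts C"
  shows "R (deck y) = R y"
proof (rule tendsto_unique[OF atin_cover_nontrivial[OF assms] _ robin_tendsto[OF assms]])
  let ?f = "\<lambda>p q. G p q - 1 / (2 * pi) * ln (geodesic_dist C p q)"
  have "((\<lambda>q. ?f (deck y) (deck q)) \<longlongrightarrow> R (deck y)) (atin (topo C) y)"
    by (rule filterlim_compose[OF robin_tendsto[OF deck_pts[OF assms]] deck_filterlim[OF assms]])
  moreover have "\<forall>\<^sub>F q in atin (topo C) y. ?f (deck y) (deck q) = ?f y q"
    using eventually_atin_neq
    by eventually_elim (use assms in \<open>simp add: green_deck geodesic_dist_deck\<close>)
  ultimately show "(?f y \<longlongrightarrow> R (deck y)) (atin (topo C) y)"
    by (rule Lim_transform_eventually)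
qed

text \<open>Smoothness off the diagonal gives joint continuity in the charts \<open>(i, s)\<close>
  and \<open>(i, - s)\<close>, whose product contains no diagonal point.\<close>

lemma green_deck_tendsto:
  assumes "y \<in> pts C"
  shows "((\<lambda>x. G x (deck y)) \<longlongrightarrow> G y (deck y)) (atin (topo C) y)"
proof -
  from assms obtain i s p where i: "i \<in> charts M" "s \<in> {1, -1}" and p: "p \<in> cdom M i"
      and y: "y = (p, orient M i s p)"
    by (rule cover_point_cases)
  have s: "- s \<in> {1, -1}"
    using i by auto
  let ?U = "coord M i ` cdom M i"
  let ?g = "\<lambda>(a, b). G (cinv C (i, s) a) (cinv C (i, - s) b)"
  have im: "coord C (i, t) ` cdom C (i, t) = ?U" if "t \<in> {1, -1}" for t
    using that i by (auto simp: sheet_eq image_iff)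
  \<comment> \<open>The signs in chart \<open>i\<close> are \<open>s\<close> and \<open>- s\<close>,
    which differ, so the two sheets are disjoint.\<close>
  have ne: "cinv C (i, s) a \<noteq> cinv C (i, - s) b" if "a \<in> ?U" "b \<in> ?U" for a b
  proof -
    have "snd (cinv C (i, s) a) i = s" "snd (cinv C (i, - s) b) i = - s"
      using that i s by (auto simp: cover_cinv orient_self)
    then show ?thesis
      using i(2) by auto
  qed
  have "smooth_off_diagonal C G"
    using G unfolding green_function_def by blast
  moreover have "(i, s) \<in> charts C" "(i, - s) \<in> charts C"
    using i s by auto
  ultimately have "smooth_on {(a, b). a \<in> coord C (i, s) ` cdom C (i, s) \<and>
      b \<in> coord C (i, - s) ` cdom C (i, - s) \<and> cinv C (i, s) a \<noteq> cinv C (i, - s) b} ?g"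
    unfolding smooth_off_diagonal_def by blast
  then have "smooth_on {(a, b). a \<in> ?U \<and> b \<in> ?U \<and> cinv C (i, s) a \<noteq> cinv C (i, - s) b} ?g"
    unfolding im[OF i(2)] im[OF s] .
  \<comment> \<open>The smoothness domain is thus a full open product, where
    \<open>continuous_on\<close> yields continuity at the point.\<close>
  also have "{(a, b). a \<in> ?U \<and> b \<in> ?U \<and> cinv C (i, s) a \<noteq> cinv C (i, - s) b} = ?U \<times> ?U"
    using ne by auto
  finally have "continuous_on (?U \<times> ?U) ?g"
    by (rule smooth_on_imp_continuous_on)
  moreover have "open (?U \<times> ?U)"
    by (intro open_Times coord_range_open i)
  ultimately have "isCont ?g (coord M i p, coord M i p)"
    using p by (simp add: continuous_on_eq_continuous_at)
  then have "((\<lambda>x. ?g (coord M i (fst x), coord M i p)) \<longlongrightarrow> ?g (coord M i p, coord M i p))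
      (atin (topo C) y)"
    unfolding y by (intro isCont_tendsto_compose[of _ ?g] tendsto_Pair cover_coord_tendsto
        i p tendsto_const)
  moreover have "?g (coord M i p, coord M i p) = G y (deck y)"
    using i s p by (simp add: cover_cinv y)
  moreover have "\<forall>\<^sub>F x in atin (topo C) y. ?g (coord M i (fst x), coord M i p) = G x (deck y)"
    unfolding eventually_atin
  proof (intro disjI2 exI conjI ballI)
    show "openin (topo C) (sheet M i s (cdom M i))"
      by (intro openin_sheet cdom_open i) auto
    show "y \<in> sheet M i s (cdom M i)"
      using i p y by (auto simp: sheet_eq)
    show "?g (coord M i (fst x), coord M i p) = G x (deck y)"
      if "x \<in> sheet M i s (cdom M i) - {y}" for x
      using that i s p y by (auto simp: sheet_eq cover_cinv)
  qed
  ultimately show ?thesis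
    by (auto intro: Lim_transform_eventually)
qed

text \<open>The Robin limit of \<open>G\<close> minus a term continuous at \<open>y\<close>.
  Symmetry of \<open>G\<close> and of the distance then exchanges the arguments.\<close>

lemma green_M_tendsto:
  assumes "y \<in> pts C"
  shows "((\<lambda>x. G x y - G x (deck y) - 1 / (2 * pi) * ln (geodesic_dist C x y))
      \<longlongrightarrow> robin_M G R y) (atin (topo C) y)"
proof -
  have "((\<lambda>x. G y x - 1 / (2 * pi) * ln (geodesic_dist C y x) - G x (deck y))
      \<longlongrightarrow> robin_M G R y) (atin (topo C) y)"
    unfolding robin_M_def
    by (intro tendsto_diff[OF robin_tendsto[OF assms] green_deck_tendsto[OF assms]])
  moreover have "\<forall>\<^sub>F x in atin (topo C) y.
      G y x - 1 / (2 * pi) * ln (geodesic_dist C y x) - G x (deck y)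
      = G x y - G x (deck y) - 1 / (2 * pi) * ln (geodesic_dist C x y)"
    using eventually_atin_neq
    by eventually_elim
      (use assms green_sym cover_geodesic_dist_commute in \<open>simp add: algebra_simps\<close>)
  ultimately show ?thesis
    by (rule Lim_transform_eventually)
qed

text \<open>The subtracted term at \<open>deck y\<close> is \<open>G (deck y) y\<close>, which
  equals \<open>G y (deck y)\<close> by symmetry.\<close>

lemma robin_M_deck: "y \<in> pts C \<Longrightarrow> robin_M G R (deck y) = robin_M G R y"
  by (simp add: robin_M_def robin_deck green_sym deck_pts)

text \<open>Distinct projections keep both \<open>(x, y)\<close> and \<open>(x, deck y)\<close> off
  the diagonal, where \<open>G\<close> is invariant; applying the involution to both arguments
  exchanges the two terms up to order. In the second argument, the sign change is built into the
  definition.\<close>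

lemma green_M_twisted:
  assumes "x \<in> pts C" "y \<in> pts C" "proj x \<noteq> proj y"
  shows "green_M G (deck x) y = - green_M G x y" "green_M G x (deck y) = - green_M G x y"
proof -
  have "x \<noteq> y" "x \<noteq> deck y"
    using assms(3) by auto
  then show "green_M G (deck x) y = - green_M G x y"
    using green_deck[of x y] green_deck[of x "deck y"] assms deck_pts
    by (simp add: green_M_def)
qed (simp add: green_M_def)

lemma green_M_distr_laplacian:
  assumes "y \<in> pts C"
  shows "has_distr_laplacian C (\<lambda>x. green_M G x y) (\<lambda>\<phi>. dirac y \<phi> - dirac (deck y) \<phi>)"
proof -
  have y: "has_distr_laplacian C (\<lambda>x. G x y) (green_source C y)"
    and dy: "has_distr_laplacian C (\<lambda>x. G x (deck y)) (green_source C (deck y))"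
    using G assms deck_pts unfolding green_function_def by blast+
  have "has_bochner_integral (area C) (\<lambda>p. green_M G p y * laplacian C \<phi> p)
      (dirac y \<phi> - dirac (deck y) \<phi>)" if "test_fun C \<phi>" for \<phi>
  proof -
    have "has_bochner_integral (area C) (\<lambda>p. G p y * laplacian C \<phi> p - G p (deck y) * laplacian C \<phi> p)
        (green_source C y \<phi> - green_source C (deck y) \<phi>)"
      using y dy that unfolding has_distr_laplacian_def by (intro has_bochner_integral_diff) auto
    \<comment> \<open>If the cover is compact, both sources subtract the same multiple of the
      integral of the test function, and this cancels.\<close>
    then show ?thesis
      by (simp add: green_M_def left_diff_distrib green_source_def split: if_splits)
  qed
  moreover have "set_integrable (area C) K (\<lambda>x. green_M G x y)" if "compactin (topo C) K" for K
    using y dy that unfolding has_distr_laplacian_def green_M_def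
    by (intro set_integral_diff) auto
  ultimately show ?thesis
    unfolding has_distr_laplacian_def by blast
qed

end

end

text \<open>Twistedness is stated outside the fibre of \<open>y\<close>, since at
  \<open>x = y\<close> and \<open>x = deck y\<close> a diagonal value of \<open>G\<close> would
  enter, which is arbitrary. The limit is taken at one lift \<open>y\<close> while the value is read
  at any lift \<open>z\<close>, which expresses independence of the choice.\<close>

theorem proposition3p5:
  fixes M :: "('p, 'i) surface"
    and G :: "'p \<times> 'i orientation \<Rightarrow> 'p \<times> 'i orientation \<Rightarrow> real"
    and R :: "'p \<times> 'i orientation \<Rightarrow> real"
  assumes "riemannian_surface M"
    and "\<not> orientable M"
    and "green_function (orientation_cover M) G"
    and "robin_function (orientation_cover M) G R"
  shows
    "(\<forall>y\<in>pts (orientation_cover M).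
        twisted_on {x \<in> pts (orientation_cover M). proj x \<noteq> proj y} (\<lambda>x. green_M G x y) \<and>
        twisted_on {x \<in> pts (orientation_cover M). proj x \<noteq> proj y} (\<lambda>x. green_M G y x) \<and>
        has_distr_laplacian (orientation_cover M) (\<lambda>x. green_M G x y)
          (\<lambda>\<phi>. dirac y \<phi> - dirac (deck y) \<phi>))
     \<and>
     regular_on (pts (orientation_cover M)) (robin_M G R) \<and>
     (\<forall>q\<in>pts M.
        \<forall>y\<in>pts (orientation_cover M). \<forall>z\<in>pts (orientation_cover M).
          proj y = q \<longrightarrow> proj z = q \<longrightarrow>
          robin_M G R z = robin_M G R y \<and>
          ((\<lambda>x. G x y - G x (deck y)
                 - 1 / (2 * pi) * ln (geodesic_dist (orientation_cover M) x y))
             \<longlongrightarrow> robin_M G R z) (atin (topo (orientation_cover M)) y))"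
proof (intro conjI ballI impI)
  note ctx = assms(1,3,4)
  fix y
  assume y: "y \<in> pts (orientation_cover M)"
  show "twisted_on {x \<in> pts (orientation_cover M). proj x \<noteq> proj y} (\<lambda>x. green_M G x y)"
    using green_M_twisted(1)[OF ctx] y by (auto simp: twisted_on_def)
  show "twisted_on {x \<in> pts (orientation_cover M). proj x \<noteq> proj y} (\<lambda>x. green_M G y x)"
    using green_M_twisted(2)[OF ctx y] by (auto simp: twisted_on_def)
  show "has_distr_laplacian (orientation_cover M) (\<lambda>x. green_M G x y)
          (\<lambda>\<phi>. dirac y \<phi> - dirac (deck y) \<phi>)"
    by (rule green_M_distr_laplacian[OF ctx y])
next
  note ctx = assms(1,3,4)
  show "regular_on (pts (orientation_cover M)) (robin_M G R)"
    using robin_M_deck[OF ctx] by (simp add: regular_on_def)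
  fix q y z
  assume y: "y \<in> pts (orientation_cover M)" and z: "z \<in> pts (orientation_cover M)"
    and "proj y = q" "proj z = q"
  \<comment> \<open>Two lifts of one point coincide or are exchanged by \<open>deck\<close>.\<close>
  then show eq: "robin_M G R z = robin_M G R y"
    using fibre[OF assms(1) y z] robin_M_deck[OF ctx y] by auto
  show "((\<lambda>x. G x y - G x (deck y)
             - 1 / (2 * pi) * ln (geodesic_dist (orientation_cover M) x y))
         \<longlongrightarrow> robin_M G R z) (atin (topo (orientation_cover M)) y)"
    unfolding eq by (rule green_M_tendsto[OF ctx y])
qed

end
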